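(* Let $(X,S)$ be the $\mathcal S$-adic subshift generated by a positive directive sequence $\boldsymbol\tau=(\tau_n:\mathcal A_{n+1}^*\to\mathcal A_n^* )_{n\ge0}$. Assume that $$\liminf_{n\to+\infty}\frac{\|\tau_{[0,n]}\|}{\langle\tau_{[0,n]}\rangle}<+\infty$$ and that $(|\mathcal A_n|)_{n\ge0}$ is bounded. Then $$\liminf_{n\to+\infty}\frac{p_X(n)}{n}<+\infty.$$
   Context: A directive sequence is a sequence $\boldsymbol\tau=(\tau_n:\mathcal A_{n+1}^*\to\mathcal A_n^* )_{n\ge0}$ of non-erasing morphisms of free monoids over finite alphabets. It is positive if for every $n\ge1$ and every $a\in\mathcal A_{n+1}$ the word $\tau_n(a)$ contains all letters of $\mathcal A_n$ (no such condition on $\tau_0$). Write $\tau_{[0,n]}=\tau_0\circ\cdots\circ\tau_n$. For a morphism $\tau:\mathcal A^*\to\mathcal B^*$, $\|\tau\|=\max_{a\in\mathcal A}|\tau(a)|$ and $\langle\tau\rangle=\min_{a\in\mathcal A}|\tau(a)|$. The $\mathcal S$-adic subshift $X_{\boldsymbol\tau}$ generated by $\boldsymbol\tau$ is the set of $x\in\mathcal A_0^{\mathbb Z}$ all of whose finite factors occur in $\tau_{[0,n]}(a)$ for some $n\ge0$ and $a\in\mathcal A_{n+1}$. $S$ is the shift map and $p_X(n)$ is the number of words of length $n$ occurring in elements of $X$. *)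

theory Defs
  imports Complex_Main "HOL-Library.Sublist" "HOL-Library.Extended_Real"
begin

text \<open>
  The alphabets are finite nonempty subsets of an arbitrary common type of letters; the
  free monoid over \<open>A\<close> is \<open>lists A\<close> with concatenation.
  A morphism is a total HOL function of which only the values on \<open>lists A\<close> matter.
  Multiplicativity forces \<open>f [] = []\<close>.
\<close>

definition word_morphism :: "'a set \<Rightarrow> 'b set \<Rightarrow> ('a list \<Rightarrow> 'b list) \<Rightarrow> bool" where
  "word_morphism A B f \<longleftrightarrow>
     (\<forall>u\<in>lists A. f u \<in> lists B) \<and>
     (\<forall>u\<in>lists A. \<forall>v\<in>lists A. f (u @ v) = f u @ f v)"

definition non_erasing :: "'a set \<Rightarrow> ('a list \<Rightarrow> 'b list) \<Rightarrow> bool" where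
  "non_erasing A f \<longleftrightarrow> (\<forall>a\<in>A. f [a] \<noteq> [])"

definition directive_sequence :: "(nat \<Rightarrow> 'a set) \<Rightarrow> (nat \<Rightarrow> 'a list \<Rightarrow> 'a list) \<Rightarrow> bool" where
  "directive_sequence A \<tau> \<longleftrightarrow>
     (\<forall>n. finite (A n) \<and> A n \<noteq> {}) \<and>
     (\<forall>n. word_morphism (A (Suc n)) (A n) (\<tau> n) \<and> non_erasing (A (Suc n)) (\<tau> n))"

definition positive_sequence :: "(nat \<Rightarrow> 'a set) \<Rightarrow> (nat \<Rightarrow> 'a list \<Rightarrow> 'a list) \<Rightarrow> bool" where
  "positive_sequence A \<tau> \<longleftrightarrow> (\<forall>n\<ge>1. \<forall>a\<in>A (Suc n). A n \<subseteq> set (\<tau> n [a]))"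

text \<open>\<open>tau_upto \<tau> n\<close> is \<open>\<tau> 0 \<circ> \<dots> \<circ> \<tau> n\<close>, a morphism from \<open>lists (A (Suc n))\<close> to \<open>lists (A 0)\<close>.\<close>

primrec tau_upto :: "(nat \<Rightarrow> 'a list \<Rightarrow> 'a list) \<Rightarrow> nat \<Rightarrow> 'a list \<Rightarrow> 'a list" where
  "tau_upto \<tau> 0 = \<tau> 0"
| "tau_upto \<tau> (Suc n) = tau_upto \<tau> n \<circ> \<tau> (Suc n)"

definition max_length :: "'a set \<Rightarrow> ('a list \<Rightarrow> 'b list) \<Rightarrow> nat" where
  "max_length A f = Max ((\<lambda>a. length (f [a])) ` A)"

definition min_length :: "'a set \<Rightarrow> ('a list \<Rightarrow> 'b list) \<Rightarrow> nat" where
  "min_length A f = Min ((\<lambda>a. length (f [a])) ` A)"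

text \<open>The factor \<open>x\<^sub>i x\<^sub>i\<^sub>+\<^sub>1 \<dots> x\<^sub>i\<^sub>+\<^sub>n\<^sub>-\<^sub>1\<close> of a bi-infinite word.\<close>

definition factor_at :: "(int \<Rightarrow> 'a) \<Rightarrow> int \<Rightarrow> nat \<Rightarrow> 'a list" where
  "factor_at x i n = map (\<lambda>k. x (i + int k)) [0..<n]"

definition sadic_subshift :: "(nat \<Rightarrow> 'a set) \<Rightarrow> (nat \<Rightarrow> 'a list \<Rightarrow> 'a list) \<Rightarrow> (int \<Rightarrow> 'a) set" where
  "sadic_subshift A \<tau> =
     {x. range x \<subseteq> A 0 \<and>
         (\<forall>i l. \<exists>n. \<exists>a\<in>A (Suc n). sublist (factor_at x i l) (tau_upto \<tau> n [a]))}"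

definition complexity :: "(int \<Rightarrow> 'a) set \<Rightarrow> nat \<Rightarrow> nat" where
  "complexity X n = card {w. \<exists>x\<in>X. \<exists>i. w = factor_at x i n}"

end

theory Submission imports Defs begin

text \<open>
  Let \<open>f = \<tau>\<^sub>0 \<circ> \<dots> \<circ> \<tau>\<^sub>n\<close> and let \<open>l\<close> be the length of its shortest letter image. By
  positivity every word of \<open>X\<close> is a factor of an image under \<open>f\<close>, so a word of length \<open>l\<close>
  already occurs in some \<open>f (a b)\<close> with letters \<open>a, b\<close>. Hence \<open>p\<^sub>X l\<close> is at most the number
  of such pairs times \<open>2 \<parallel>f\<parallel> + 1\<close>, which is linear in \<open>l\<close> for infinitely many \<open>n\<close>. If these
  \<open>l\<close> stay bounded, then so do the lengths of the words of \<open>X\<close>, and \<open>X\<close> is empty.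
\<close>

section \<open>Word morphisms and the factors of their images\<close>

lemma word_morphism_Nil:
  assumes "word_morphism A B f"
  shows "f [] = []"
  using assms unfolding word_morphism_def by (metis append_self_conv lists.Nil)

lemma word_morphism_append:
  assumes "word_morphism A B f" "u \<in> lists A" "v \<in> lists A"
  shows "f (u @ v) = f u @ f v"
  using assms unfolding word_morphism_def by blast

lemma word_morphism_Cons:
  assumes "word_morphism A B f" "a \<in> A" "u \<in> lists A"
  shows "f (a # u) = f [a] @ f u"
  using word_morphism_append[OF assms(1), of "[a]" u] assms by simp

lemma word_morphism_comp:
  assumes "word_morphism B C f" "word_morphism A B g"
  shows "word_morphism A C (f \<circ> g)"
  using assms unfolding word_morphism_def by auto

lemma word_morphism_sublist:
  assumes f: "word_morphism A B f" and u: "u \<in> lists A" and a: "a \<in> set u"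
  shows "sublist (f [a]) (f u)"
proof -
  obtain p s where p: "u = p @ a # s" using a by (meson split_list)
  then have "f u = f p @ f [a] @ f s"
    using word_morphism_append[OF f, of p "a # s"] word_morphism_Cons[OF f, of a s] u by simp
  then show ?thesis by simp
qed

text \<open>Strip the first letter \<open>c\<close> off \<open>u\<close>. A factor of
  \<open>f [c] @ f u\<close> lies in one of the two halves or straddles the cut. When it straddles,
  its right part is a prefix of \<open>f u\<close> no longer than any letter image, so it fits
  inside the image of the first letter of \<open>u\<close>.\<close>

lemma sublist_morphism_image_pair:
  assumes f: "word_morphism A B f" and "A \<noteq> {}"
    and l: "\<And>a. a \<in> A \<Longrightarrow> length w \<le> length (f [a])"
    and "u \<in> lists A" "sublist w (f u)"
  shows "\<exists>a\<in>A. \<exists>b\<in>A. sublist w (f [a] @ f [b])"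
  using assms(4,5)
proof (induction u rule: list.induct)
  case Nil
  then show ?case using \<open>A \<noteq> {}\<close> word_morphism_Nil[OF f] by auto
next
  case (Cons c u)
  then have c: "c \<in> A" and u: "u \<in> lists A" by auto
  from Cons.prems(2) consider "sublist w (f [c])" | "sublist w (f u)"
    | w1 w2 where "w = w1 @ w2" "suffix w1 (f [c])" "prefix w2 (f u)"
    unfolding word_morphism_Cons[OF f c u] sublist_append by blast
  then show ?case
  proof cases
    case 1
    then show ?thesis using c by (meson sublist_append)
  next
    case 2
    then show ?thesis using Cons.IH u by blast
  next
    case 3
    have "\<exists>b\<in>A. prefix w2 (f [b])"
    proof (cases u)
      case Nil
      \<comment> \<open>Here \<open>w2\<close> is empty, so \<open>c\<close> itself serves as
        \<open>b\<close>.\<close>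
      then show ?thesis using 3 c word_morphism_Nil[OF f] by auto
    next
      case (Cons d v)
      then have d: "d \<in> A" "v \<in> lists A" using u by auto
      have "prefix w2 (f [d] @ f v)"
        using 3 Cons word_morphism_Cons[OF f d] by simp
      moreover have "length w2 \<le> length (f [d])" using l[OF d(1)] 3 by simp
      ultimately have "prefix w2 (f [d])"
        by (metis prefix_length_prefix prefixI)
      then show ?thesis using d by blast
    qed
    then show ?thesis using 3 c by (meson sublist_append)
  qed
qed

lemma factors_of_length:
  shows "finite {w. length w = l \<and> sublist w v}"
    and "card {w. length w = l \<and> sublist w v} \<le> Suc (length v)"
proof -
  have sub: "{w. length w = l \<and> sublist w v} \<subseteq> (\<lambda>i. take l (drop i v)) ` {..length v}"
  proof
    fix w assume "w \<in> {w. length w = l \<and> sublist w v}"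
    then obtain p s where "length w = l" "v = p @ w @ s" by (auto simp: sublist_def)
    then show "w \<in> (\<lambda>i. take l (drop i v)) ` {..length v}"
      by (intro image_eqI[of _ _ "length p"]) auto
  qed
  then show "finite {w. length w = l \<and> sublist w v}" by (rule finite_subset) simp
  have "card {w. length w = l \<and> sublist w v} \<le> card ((\<lambda>i. take l (drop i v)) ` {..length v})"
    using sub by (rule card_mono[rotated]) simp
  also have "\<dots> \<le> card {..length v}" by (rule card_image_le) simp
  finally show "card {w. length w = l \<and> sublist w v} \<le> Suc (length v)" by simp
qed

lemma length_le_max_length:
  assumes "finite A" "a \<in> A"
  shows "length (f [a]) \<le> max_length A f"
  using assms by (simp add: max_length_def)

lemma min_length_le_length:
  assumes "finite A" "a \<in> A"
  shows "min_length A f \<le> length (f [a])"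
  using assms by (simp add: min_length_def)

lemma le_min_lengthI:
  assumes "finite A" "A \<noteq> {}" "\<And>a. a \<in> A \<Longrightarrow> k \<le> length (f [a])"
  shows "k \<le> min_length A f"
  using assms by (simp add: min_length_def)

lemma card_factors_morphism_image:
  assumes f: "word_morphism A B f" and A: "finite A" "A \<noteq> {}"
    and W: "\<And>w. w \<in> W \<Longrightarrow> length w = min_length A f \<and> (\<exists>u\<in>lists A. sublist w (f u))"
  shows "card W \<le> (card A)\<^sup>2 * Suc (2 * max_length A f)"
proof -
  \<comment> \<open>\<open>F (a, b)\<close> collects the candidates that the pair \<open>a\<close>,
    \<open>b\<close> contributes; these sets cover \<open>W\<close>, and each has at most one
    element per starting position.\<close>
  define F where "F = (\<lambda>(a, b). {w. length w = min_length A f \<and> sublist w (f [a] @ f [b])})"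
  have finF: "finite (F p)" for p
    unfolding F_def using factors_of_length(1) by (cases p) auto
  have cardF: "card (F p) \<le> Suc (2 * max_length A f)" if "p \<in> A \<times> A" for p
  proof -
    obtain a b where p: "p = (a, b)" "a \<in> A" "b \<in> A" using \<open>p \<in> A \<times> A\<close> by (rule SigmaE)
    have "card (F p) \<le> Suc (length (f [a] @ f [b]))"
      unfolding F_def p prod.case by (rule factors_of_length(2))
    also have "\<dots> \<le> Suc (2 * max_length A f)"
      using length_le_max_length[OF A(1) p(2), of f] length_le_max_length[OF A(1) p(3), of f] by simp
    finally show ?thesis .
  qed
  have "W \<subseteq> (\<Union>p\<in>A \<times> A. F p)"
  proof
    fix w assume "w \<in> W"
    then obtain u where w: "length w = min_length A f" "u \<in> lists A" "sublist w (f u)"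
      using W by blast
    then obtain a b where "a \<in> A" "b \<in> A" "sublist w (f [a] @ f [b])"
      using sublist_morphism_image_pair[OF f A(2), of w u] min_length_le_length[OF A(1), of _ f]
      by auto
    then show "w \<in> (\<Union>p\<in>A \<times> A. F p)" using w by (auto simp: F_def)
  qed
  then have "card W \<le> card (\<Union>p\<in>A \<times> A. F p)"
    by (rule card_mono[rotated]) (use A finF in auto)
  also have "\<dots> \<le> (\<Sum>p\<in>A \<times> A. card (F p))" by (rule card_UN_le) (use A in simp)
  also have "\<dots> \<le> card (A \<times> A) * Suc (2 * max_length A f)"
    using sum_bounded_above[of "A \<times> A" "\<lambda>p. card (F p)", OF cardF] by simp
  finally show ?thesis by (simp add: card_cartesian_product power2_eq_square)
qed

section \<open>The composed morphisms of a directive sequence\<close>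

lemma tau_upto_morphism:
  assumes "directive_sequence A \<tau>"
  shows "word_morphism (A (Suc n)) (A 0) (tau_upto \<tau> n)"
proof (induction n)
  case 0
  then show ?case using assms by (simp add: directive_sequence_def)
next
  case (Suc n)
  have "word_morphism (A (Suc (Suc n))) (A (Suc n)) (\<tau> (Suc n))"
    using assms by (simp add: directive_sequence_def)
  from word_morphism_comp[OF Suc this] show ?case by (simp only: tau_upto.simps)
qed

text \<open>The inner morphisms with indices \<open>n + 1\<close> to \<open>k\<close> are absorbed
  one by one into the argument, so words generated at a deep level can be read as images under
  \<open>tau_upto \<tau> n\<close>.\<close>

lemma tau_upto_factor:
  assumes "directive_sequence A \<tau>" "n \<le> k" "u \<in> lists (A (Suc k))"
  shows "\<exists>v\<in>lists (A (Suc n)). tau_upto \<tau> k u = tau_upto \<tau> n v"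
  using assms(2,3)
proof (induction k arbitrary: u rule: dec_induct)
  case base
  then show ?case by blast
next
  case (step k)
  have "\<tau> (Suc k) u \<in> lists (A (Suc k))"
    using assms(1) step.prems unfolding directive_sequence_def word_morphism_def by blast
  from step.IH[OF this] show ?case by simp
qed

lemma sublist_tau_upto_Suc:
  assumes D: "directive_sequence A \<tau>" and P: "positive_sequence A \<tau>"
    and a: "a \<in> A (Suc n)" and b: "b \<in> A (Suc (Suc n))"
  shows "sublist (tau_upto \<tau> n [a]) (tau_upto \<tau> (Suc n) [b])"
proof -
  have "\<tau> (Suc n) [b] \<in> lists (A (Suc n))"
    using D b unfolding directive_sequence_def word_morphism_def by auto
  moreover have "a \<in> set (\<tau> (Suc n) [b])"
    using P a b unfolding positive_sequence_def by auto
  ultimately show ?thesis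
    using word_morphism_sublist[OF tau_upto_morphism[OF D]] by simp
qed

text \<open>The one-level inclusions are chained through an arbitrary letter of each intermediate
  alphabet. The strict \<open>n < k\<close> matters: images of distinct letters at the same level
  need not contain each other.\<close>

lemma sublist_tau_upto:
  assumes D: "directive_sequence A \<tau>" and P: "positive_sequence A \<tau>"
    and "n < k" "a \<in> A (Suc n)" "b \<in> A (Suc k)"
  shows "sublist (tau_upto \<tau> n [a]) (tau_upto \<tau> k [b])"
  using assms(3,5)
proof (induction k arbitrary: b)
  case (Suc k)
  show ?case
  proof (cases "n = k")
    case True
    then show ?thesis using sublist_tau_upto_Suc[OF D P assms(4)] Suc.prems by simp
  next
    case False
    obtain c where c: "c \<in> A (Suc k)" using D unfolding directive_sequence_def by blast
    with Suc False have "sublist (tau_upto \<tau> n [a]) (tau_upto \<tau> k [c])" by simp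
    also have "sublist \<dots> (tau_upto \<tau> (Suc k) [b])"
      using sublist_tau_upto_Suc[OF D P c Suc.prems(2)] .
    finally show ?thesis .
  qed
qed simp

text \<open>Every letter image contains a letter image of the level before, hence monotonicity; it
  starts from at least 1 because \<open>\<tau> 0\<close> is non-erasing. These lengths later serve
  as the lengths at which complexity is estimated.\<close>

lemma min_length_tau_upto:
  assumes D: "directive_sequence A \<tau>" and P: "positive_sequence A \<tau>"
  shows "0 < min_length (A (Suc n)) (tau_upto \<tau> n)"
    and "mono (\<lambda>n. min_length (A (Suc n)) (tau_upto \<tau> n))"
proof -
  have A: "finite (A k)" "A k \<noteq> {}" for k using D by (auto simp: directive_sequence_def)
  have step: "min_length (A (Suc n)) (tau_upto \<tau> n)
      \<le> min_length (A (Suc (Suc n))) (tau_upto \<tau> (Suc n))" for n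
  proof (rule le_min_lengthI[OF A])
    fix b assume b: "b \<in> A (Suc (Suc n))"
    obtain a where a: "a \<in> A (Suc n)" using A(2) by blast
    show "min_length (A (Suc n)) (tau_upto \<tau> n) \<le> length (tau_upto \<tau> (Suc n) [b])"
      using min_length_le_length[OF A(1) a] sublist_length_le[OF sublist_tau_upto_Suc[OF D P a b]]
      by (rule order_trans)
  qed
  show M: "mono (\<lambda>n. min_length (A (Suc n)) (tau_upto \<tau> n))"
    using step by (rule mono_iff_le_Suc[THEN iffD2, rule_format])
  have "1 \<le> min_length (A (Suc 0)) (tau_upto \<tau> 0)"
    using D by (intro le_min_lengthI[OF A])
      (auto simp: directive_sequence_def non_erasing_def Suc_le_eq)
  then show "0 < min_length (A (Suc n)) (tau_upto \<tau> n)"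
    using monoD[OF M, of 0 n] by simp
qed

section \<open>Factors and complexity of the subshift\<close>

text \<open>Membership provides only one level and one letter for each factor; positivity spreads
  the factor to all letters of all deeper levels.\<close>

lemma sadic_subshift_factor:
  assumes D: "directive_sequence A \<tau>" and P: "positive_sequence A \<tau>"
    and x: "x \<in> sadic_subshift A \<tau>"
  shows "\<forall>\<^sub>F k in sequentially. \<forall>b\<in>A (Suc k). sublist (factor_at x i l) (tau_upto \<tau> k [b])"
proof -
  obtain m a where m: "a \<in> A (Suc m)" "sublist (factor_at x i l) (tau_upto \<tau> m [a])"
    using x unfolding sadic_subshift_def by blast
  show ?thesis
    using eventually_gt_at_top[of m]
    by eventually_elim (use m sublist_tau_upto[OF D P] sublist_order.order_trans in blast)
qed

lemma complexity_sadic_le: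
  assumes D: "directive_sequence A \<tau>" and P: "positive_sequence A \<tau>"
  shows "complexity (sadic_subshift A \<tau>) (min_length (A (Suc n)) (tau_upto \<tau> n))
    \<le> (card (A (Suc n)))\<^sup>2 * Suc (2 * max_length (A (Suc n)) (tau_upto \<tau> n))"
  unfolding complexity_def
proof (rule card_factors_morphism_image[OF tau_upto_morphism[OF D]], goal_cases)
  case (3 w)
  then obtain x i where x: "x \<in> sadic_subshift A \<tau>"
    and w: "w = factor_at x i (min_length (A (Suc n)) (tau_upto \<tau> n))" by blast
  have "\<forall>\<^sub>F k in sequentially. n \<le> k \<and> (\<forall>b\<in>A (Suc k). sublist w (tau_upto \<tau> k [b]))"
    unfolding w using sadic_subshift_factor[OF D P x] eventually_ge_at_top
    by (intro eventually_conj) auto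
  \<comment> \<open>The level \<open>k\<close> at which \<open>w\<close> appears must be at least
    \<open>n\<close>, so that the image containing \<open>w\<close> can be rewritten as an image
    under \<open>tau_upto \<tau> n\<close>.\<close>
  then obtain k where k: "n \<le> k" "\<forall>b\<in>A (Suc k). sublist w (tau_upto \<tau> k [b])"
    using eventually_happens'[OF sequentially_bot] by blast
  obtain b where b: "b \<in> A (Suc k)" using D unfolding directive_sequence_def by blast
  then obtain v where "v \<in> lists (A (Suc n))" "tau_upto \<tau> k [b] = tau_upto \<tau> n v"
    using tau_upto_factor[OF D k(1), of "[b]"] by auto
  moreover have "length w = min_length (A (Suc n)) (tau_upto \<tau> n)"
    by (simp add: w factor_at_def)
  ultimately show ?case using k(2) b by metis
qed (use D in \<open>auto simp: directive_sequence_def\<close>)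

text \<open>A point of the subshift has a factor of length \<open>L + 1\<close>. It would occur in
  every letter image at all deep levels, including one where these images have length at most
  \<open>L\<close>.\<close>

lemma sadic_subshift_empty:
  assumes D: "directive_sequence A \<tau>" and P: "positive_sequence A \<tau>"
    and bounded: "\<exists>\<^sub>F n in sequentially. max_length (A (Suc n)) (tau_upto \<tau> n) \<le> L"
  shows "sadic_subshift A \<tau> = {}"
proof (rule ccontr)
  assume "sadic_subshift A \<tau> \<noteq> {}"
  then obtain x where "x \<in> sadic_subshift A \<tau>" by blast
  from frequently_eventually_conj[OF bounded sadic_subshift_factor[OF D P this, of 0 "Suc L"]]
  obtain n where n: "max_length (A (Suc n)) (tau_upto \<tau> n) \<le> L"
    "\<forall>b\<in>A (Suc n). sublist (factor_at x 0 (Suc L)) (tau_upto \<tau> n [b])"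
    using frequently_ex by blast
  obtain b where b: "b \<in> A (Suc n)" "finite (A (Suc n))"
    using D unfolding directive_sequence_def by blast
  have "Suc L \<le> length (tau_upto \<tau> n [b])"
    using n(2) b(1) sublist_length_le[of "factor_at x 0 (Suc L)"] by (force simp: factor_at_def)
  also have "\<dots> \<le> L" using length_le_max_length[OF b(2,1), of "tau_upto \<tau> n"] n(1) by simp
  finally show False by simp
qed

section \<open>Finite lower limits and the final estimate\<close>

lemma liminf_less_infty_iff:
  fixes r :: "nat \<Rightarrow> real"
  shows "liminf (\<lambda>n. ereal (r n)) < \<infinity> \<longleftrightarrow> (\<exists>C. \<exists>\<^sub>F n in sequentially. r n \<le> C)"
proof
  assume "liminf (\<lambda>n. ereal (r n)) < \<infinity>"
  then obtain C where C: "liminf (\<lambda>n. ereal (r n)) < ereal C"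
    using less_PInf_Ex_of_nat by auto
  have "\<exists>\<^sub>F n in sequentially. r n \<le> C"
  proof (rule ccontr)
    assume "\<not> (\<exists>\<^sub>F n in sequentially. r n \<le> C)"
    then have "\<forall>\<^sub>F n in sequentially. ereal C \<le> ereal (r n)"
      by (auto simp: not_frequently elim: eventually_mono)
    then show False using Liminf_bounded[of "ereal C"] C by (metis leD)
  qed
  then show "\<exists>C. \<exists>\<^sub>F n in sequentially. r n \<le> C" ..
next
  assume "\<exists>C. \<exists>\<^sub>F n in sequentially. r n \<le> C"
  then obtain C where C: "\<exists>\<^sub>F n in sequentially. r n \<le> C" ..
  show "liminf (\<lambda>n. ereal (r n)) < \<infinity>"
  proof (rule ccontr)
    assume "\<not> liminf (\<lambda>n. ereal (r n)) < \<infinity>"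
    then have "ereal C < liminf (\<lambda>n. ereal (r n))" by simp
    from less_LiminfD[OF this] C show False
      by (simp add: frequently_def not_le)
  qed
qed

theorem corollary6p7:
  fixes A :: "nat \<Rightarrow> 'a set" and \<tau> :: "nat \<Rightarrow> 'a list \<Rightarrow> 'a list"
    and X :: "(int \<Rightarrow> 'a) set"
  assumes "directive_sequence A \<tau>"
    and "positive_sequence A \<tau>"
    and "X = sadic_subshift A \<tau>"
    and "liminf (\<lambda>n. ereal (real (max_length (A (Suc n)) (tau_upto \<tau> n)) /
                            real (min_length (A (Suc n)) (tau_upto \<tau> n)))) < \<infinity>"
    and "bdd_above (range (\<lambda>n. card (A n)))"
  shows "liminf (\<lambda>n. ereal (real (complexity X n) / real n)) < \<infinity>"
proof -
  note D = assms(1) and P = assms(2)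
  define M m where "M n = max_length (A (Suc n)) (tau_upto \<tau> n)"
    and "m n = min_length (A (Suc n)) (tau_upto \<tau> n)" for n
  have m_pos: "0 < m n" for n unfolding m_def by (rule min_length_tau_upto[OF D P])
  have m_mono: "mono m" unfolding m_def by (rule min_length_tau_upto[OF D P])
  obtain C where "\<exists>\<^sub>F n in sequentially. real (M n) / real (m n) \<le> C"
    using assms(4) unfolding liminf_less_infty_iff M_def m_def by blast
  then have C: "\<exists>\<^sub>F n in sequentially. real (M n) \<le> C * real (m n)"
    using m_pos by (simp add: pos_divide_le_eq)
  obtain K where K: "card (A n) \<le> K" for n
    using assms(5) by (auto simp: bdd_above_def)
  show ?thesis
  proof (cases "\<exists>L. \<forall>n. m n \<le> L")
    case True
    then obtain L where L: "m n \<le> L" for n by blast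
    \<comment> \<open>Bounded shortest images together with the ratio bound give bounded longest
      images infinitely often. The absolute value of \<open>C\<close> is taken because its sign is
      not recorded.\<close>
    have "\<exists>\<^sub>F n in sequentially. M n \<le> nat \<lceil>\<bar>C\<bar> * real L\<rceil>"
      using C
    proof (rule frequently_elim1)
      fix n assume "real (M n) \<le> C * real (m n)"
      also have "\<dots> \<le> \<bar>C\<bar> * real L" using L[of n] by (intro mult_mono) auto
      finally show "M n \<le> nat \<lceil>\<bar>C\<bar> * real L\<rceil>" by linarith
    qed
    then have "X = {}" using sadic_subshift_empty[OF D P] assms(3) M_def by simp
    then show ?thesis by (simp add: complexity_def Liminf_const)
  next
    case False
    \<comment> \<open>The factor \<open>K\<^sup>2\<close> bounds the number of letter pairs, and
      \<open>1 + 2 * C\<close> comes from \<open>1 + 2 * M n\<close> after dividing by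
      \<open>m n\<close>.\<close>
    have "\<exists>\<^sub>F l in sequentially. real (complexity X l) / real l \<le> (real K)\<^sup>2 * (1 + 2 * C)"
      unfolding frequently_sequentially
    proof
      fix N
      \<comment> \<open>Since \<open>m\<close> is monotone and unbounded, \<open>N \<le> m n\<close>
        holds for all large \<open>n\<close>, hence at some level with the ratio bound. There
        \<open>l = m n\<close> is the witness.\<close>
      obtain n0 where "N \<le> m n0" using False by (meson nle_le)
      with m_mono have "\<forall>\<^sub>F n in sequentially. N \<le> m n"
        by (intro eventually_sequentiallyI[of n0]) (meson monoD order_trans)
      from frequently_eventually_conj[OF C this]
      obtain n where n: "real (M n) \<le> C * real (m n)" "N \<le> m n"
        using frequently_ex by blast
      have "complexity X (m n) \<le> (card (A (Suc n)))\<^sup>2 * Suc (2 * M n)"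
        unfolding assms(3) m_def M_def by (rule complexity_sadic_le[OF D P])
      also have "\<dots> \<le> K\<^sup>2 * Suc (2 * M n)"
        using K by (intro mult_right_mono power_mono) auto
      finally have "real (complexity X (m n)) \<le> (real K)\<^sup>2 * (1 + 2 * real (M n))"
        by (metis of_nat_Suc of_nat_le_iff of_nat_mult of_nat_numeral of_nat_power)
      \<comment> \<open>The summand 1 is absorbed using \<open>1 \<le> m n\<close>.\<close>
      also have "\<dots> \<le> (real K)\<^sup>2 * ((1 + 2 * C) * real (m n))"
        using n m_pos[of n] by (intro mult_left_mono) (auto simp: algebra_simps)
      finally have "real (complexity X (m n)) / real (m n) \<le> (real K)\<^sup>2 * (1 + 2 * C)"
        using m_pos[of n] by (simp add: pos_divide_le_eq mult.assoc)
      then show "\<exists>l\<ge>N. real (complexity X l) / real l \<le> (real K)\<^sup>2 * (1 + 2 * C)"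
        using n(2) by blast
    qed
    then show ?thesis unfolding liminf_less_infty_iff by blast
  qed
qed

end
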